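(* For every $N$ and every request sequence $I$ respecting the path access graph $P_N$, $$\mathrm{LRU}^{P_N}_W(I)\le \mathrm{FIFO}^{P_N}_W(I).$$
   Context: Paging: a cache of size $k\ge1$, initially empty; on a request to a page not in cache (a fault) the page is brought in, evicting a page if the cache is full; $\mathrm{A}(I)$ is the number of faults of algorithm $\mathrm{A}$ on sequence $I$. LRU evicts the least recently requested page in cache; FIFO evicts the page that has been in cache the longest. An access graph is an undirected graph whose vertices are the pages; a sequence respects it if any two consecutive requests are to the same page or to adjacent vertices. $P_N$ is the path graph on $N$ vertices. For an algorithm $\mathrm{A}$ and access graph $G$, $\mathrm{A}^G_W(I)=\max_\sigma \mathrm{A}(\sigma(I))$, the maximum over all permutations $\sigma$ of the requests of $I$ such that the reordered sequence $\sigma(I)$ respects $G$. *)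

theory Defs
  imports "HOL-Combinatorics.Permutations"
begin

section \<open>Paging with LRU and FIFO\<close>

text \<open>
  The stamp of a cached page is the time of its most recent request under LRU and the time at
  which it was brought into the cache under FIFO. In both cases the page with the smallest stamp
  is the one to evict. Stamps of pages outside the cache carry no meaning.
\<close>

record 'a paging_state =
  cache :: "'a set"
  stamp :: "'a \<Rightarrow> nat"
  clock :: nat

definition initial :: "'a paging_state" where
  "initial = \<lparr>cache = {}, stamp = (\<lambda>_. 0), clock = 0\<rparr>"

definition make_room :: "nat \<Rightarrow> 'a paging_state \<Rightarrow> 'a set" where
  "make_room k s =
     (if card (cache s) = k then cache s - {arg_min_on (stamp s) (cache s)} else cache s)"

definition lru_step :: "nat \<Rightarrow> 'a paging_state \<Rightarrow> 'a \<Rightarrow> 'a paging_state" where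
  "lru_step k s p =
     \<lparr>cache = (if p \<in> cache s then cache s else insert p (make_room k s)),
      stamp = (stamp s)(p := clock s),
      clock = Suc (clock s)\<rparr>"

definition fifo_step :: "nat \<Rightarrow> 'a paging_state \<Rightarrow> 'a \<Rightarrow> 'a paging_state" where
  "fifo_step k s p =
     \<lparr>cache = (if p \<in> cache s then cache s else insert p (make_room k s)),
      stamp = (if p \<in> cache s then stamp s else (stamp s)(p := clock s)),
      clock = Suc (clock s)\<rparr>"

fun faults :: "('a paging_state \<Rightarrow> 'a \<Rightarrow> 'a paging_state) \<Rightarrow> 'a paging_state \<Rightarrow> 'a list \<Rightarrow> nat" where
  "faults step s [] = 0"
| "faults step s (p # ps) = (if p \<in> cache s then 0 else 1) + faults step (step s p) ps"

definition LRU :: "nat \<Rightarrow> 'a list \<Rightarrow> nat" where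
  "LRU k I = faults (lru_step k) initial I"

definition FIFO :: "nat \<Rightarrow> 'a list \<Rightarrow> nat" where
  "FIFO k I = faults (fifo_step k) initial I"

text \<open>The evicted page is uniquely determined, and the cache never holds more than \<open>k\<close> pages.\<close>

definition valid_state :: "nat \<Rightarrow> 'a paging_state \<Rightarrow> bool" where
  "valid_state k s \<longleftrightarrow> finite (cache s) \<and> card (cache s) \<le> k \<and> inj_on (stamp s) (cache s) \<and>
     (\<forall>p \<in> cache s. stamp s p < clock s)"

lemma valid_state_initial: "valid_state k initial"
  by (simp add: valid_state_def initial_def)

lemma make_room_valid:
  assumes "k \<ge> 1" "valid_state k s"
  shows "finite (make_room k s)" "card (make_room k s) < k" "make_room k s \<subseteq> cache s"
proof -
  have ne: "arg_min_on (stamp s) (cache s) \<in> cache s" if "card (cache s) = k"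
    using that assms arg_min_if_finite(1)[of "cache s" "stamp s"]
    by (fastforce simp: valid_state_def)
  show "finite (make_room k s)" "make_room k s \<subseteq> cache s"
    using assms by (auto simp: make_room_def valid_state_def)
  show "card (make_room k s) < k"
    using assms ne by (auto simp: make_room_def valid_state_def)
qed

lemma valid_state_step:
  assumes "k \<ge> 1" "valid_state k s"
  shows "valid_state k (lru_step k s p)" "valid_state k (fifo_step k s p)"
proof -
  note r = make_room_valid[OF assms]
  have c: "finite (insert p (make_room k s))" "card (insert p (make_room k s)) \<le> k"
    using r by (auto simp: card_insert_if)
  have v: "finite (cache s)" "card (cache s) \<le> k" "inj_on (stamp s) (cache s)"
    "\<forall>q \<in> cache s. stamp s q < clock s"
    using assms by (auto simp: valid_state_def)
  have i: "inj_on ((stamp s)(p := clock s)) (insert p C)" if "C \<subseteq> cache s" for C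
    using v(3,4) that by (fastforce intro!: inj_onI dest: inj_onD split: if_splits)
  have b: "\<forall>q \<in> insert p C. ((stamp s)(p := clock s)) q < Suc (clock s)"
    if "C \<subseteq> cache s" for C
    using v(4) that by (simp add: less_Suc_eq subset_iff)
  note full = c i[OF r(3)] b[OF r(3)]
  note hit = i[OF subset_refl] b[OF subset_refl]
  show "valid_state k (lru_step k s p)"
  proof (cases "p \<in> cache s")
    case True
    then show ?thesis
      using v(1,2) hit unfolding valid_state_def lru_step_def by (simp add: insert_absorb)
  next
    case False
    then show ?thesis
      using full unfolding valid_state_def lru_step_def by (simp del: inj_on_insert)
  qed
  show "valid_state k (fifo_step k s p)"
  proof (cases "p \<in> cache s")
    case True
    then show ?thesis
      using v unfolding valid_state_def fifo_step_def by (simp add: less_Suc_eq)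
  next
    case False
    then show ?thesis
      using full unfolding valid_state_def fifo_step_def by (simp del: inj_on_insert)
  qed
qed


section \<open>Access graphs\<close>

record 'a ugraph =
  vertices :: "'a set"
  edges :: "'a set set"

definition path_graph :: "nat \<Rightarrow> nat ugraph" where
  "path_graph N = \<lparr>vertices = {..<N}, edges = {{i, Suc i} | i. Suc i < N}\<rparr>"

definition respects_graph :: "'a ugraph \<Rightarrow> 'a list \<Rightarrow> bool" where
  "respects_graph G I \<longleftrightarrow>
     set I \<subseteq> vertices G \<and> successively (\<lambda>p q. p = q \<or> {p, q} \<in> edges G) I"


section \<open>Worst-order performance\<close>

definition worst_order :: "('a list \<Rightarrow> nat) \<Rightarrow> 'a ugraph \<Rightarrow> 'a list \<Rightarrow> nat" where
  "worst_order A G I =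
     Max {A (permute_list \<sigma> I) | \<sigma>.
            \<sigma> permutes {..<length I} \<and> respects_graph G (permute_list \<sigma> I)}"

text \<open>If \<open>I\<close> itself respects_graph the graph, the maximum ranges over a finite nonempty set.\<close>

lemma worst_order_set:
  "finite {A (permute_list \<sigma> I) | \<sigma>.
      \<sigma> permutes {..<length I} \<and> respects_graph G (permute_list \<sigma> I)}"
  "respects_graph G I \<Longrightarrow> A I \<in> {A (permute_list \<sigma> I) | \<sigma>.
      \<sigma> permutes {..<length I} \<and> respects_graph G (permute_list \<sigma> I)}"
proof -
  have "finite {\<sigma>. \<sigma> permutes {..<length I}}"
    by (simp add: finite_permutations)
  then show "finite {A (permute_list \<sigma> I) | \<sigma>.
      \<sigma> permutes {..<length I} \<and> respects_graph G (permute_list \<sigma> I)}"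
    by (rule finite_surj[where f = "\<lambda>\<sigma>. A (permute_list \<sigma> I)"]) auto
  show "A I \<in> {A (permute_list \<sigma> I) | \<sigma>.
      \<sigma> permutes {..<length I} \<and> respects_graph G (permute_list \<sigma> I)}" if "respects_graph G I"
    using that by (auto intro!: exI[of _ id] permutes_id)
qed

end

theory Submission imports Defs begin

text \<open>
  On a path, LRU faults at most as often as FIFO on every single sequence, so reordering plays no
  role. The pages in the LRU cache form an interval around the current page \<open>p\<close>, and on a fault
  a full LRU cache drops the endpoint opposite to the direction of travel. If \<open>L\<close> and \<open>F\<close> are
  the caches of LRU and FIFO,
  the number of faults that FIFO can still save against LRU is at most the larger of the surplus
  of \<open>F\<close> over \<open>L\<close> on the two rays starting at \<open>p\<close>; this quantity serves as a potential.
\<close>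

section \<open>The potential and its change in one step\<close>

definition potential :: "'a set \<Rightarrow> 'a set \<Rightarrow> 'a set \<Rightarrow> 'a set \<Rightarrow> nat" where
  "potential U V L F =
     max (card (F \<inter> U) - card (L \<inter> U)) (card (F \<inter> V) - card (L \<inter> V))"

lemma potential_commute: "potential U V L F = potential V U L F"
  by (simp add: potential_def max.commute)

text \<open>
  \<open>U\<close> is the ray from \<open>p\<close> in the direction of travel and \<open>V\<close> the ray in the opposite direction.
  Stating the step for abstract rays covers both directions.
\<close>

lemma potential_step:
  assumes fin: "finite L" "finite F" "finite F'"
    and p: "p \<in> L" "p \<in> F" "p \<in> U" "p \<in> V"
    and q: "q \<in> U" "q \<notin> V"
    and U': "U' = U - {p}" and V': "V' = insert q V"
    and UV: "U \<inter> V = {p}" "U \<union> V = UNIV"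
    and same: "card L = k \<or> F = L"
    and hit: "q \<in> F \<Longrightarrow> F' = F" and miss: "F' \<subseteq> insert q F" and cardF': "card F' \<le> k"
    and coldF: "card F \<noteq> k \<Longrightarrow> q \<notin> F \<Longrightarrow> F' = insert q F"
    and hitL: "q \<in> L \<Longrightarrow> L' = L"
    and end_point: "q \<notin> L \<Longrightarrow> L \<inter> U = {p}"
    and coldL: "card L \<noteq> k \<Longrightarrow> q \<notin> L \<Longrightarrow> L' = insert q L"
    and fullL: "q \<notin> L \<Longrightarrow> card L = k \<Longrightarrow> \<exists>e\<in>L \<inter> V. L' = insert q (L - {e})"
  shows "(if q \<in> L then 0 else 1) + potential U' V' L' F'
         \<le> (if q \<in> F then 0 else 1) + potential U V L F"
proof (cases "q \<in> L")
  \<comment> \<open>If LRU hits, \<open>p\<close> leaves the ray ahead and \<open>q\<close> joins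
    the ray behind. Only a FIFO fault on \<open>q\<close> can raise the potential: by at most one,
    on the ray ahead, and that fault covers the increase.\<close>
  case True
  then have L': "L' = L" by (rule hitL)
  have LU: "card (L \<inter> U) = Suc (card (L \<inter> U'))"
  proof -
    have "L \<inter> U = insert p (L \<inter> U')" using p U' by auto
    then show ?thesis using fin U' by simp
  qed
  have LV: "card (L \<inter> V') = Suc (card (L \<inter> V))"
  proof -
    have "L \<inter> V' = insert q (L \<inter> V)" using True V' by auto
    then show ?thesis using fin q by simp
  qed
  have FU: "card (F \<inter> U) = Suc (card (F \<inter> U'))"
  proof -
    have "F \<inter> U = insert p (F \<inter> U')" using p U' by auto
    then show ?thesis using fin U' by simp
  qed
  have FV: "card (F' \<inter> V') \<le> Suc (card (F \<inter> V))"
  proof -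
    have "card (F' \<inter> V') \<le> card (insert q (F \<inter> V))"
      using miss V' fin by (intro card_mono) auto
    also have "\<dots> = Suc (card (F \<inter> V))" using fin q by simp
    finally show ?thesis .
  qed
  show ?thesis
  proof (cases "q \<in> F")
    case True
    then show ?thesis using \<open>q \<in> L\<close> L' LU LV FU FV hit by (auto simp: potential_def)
  next
    case False
    have "F' \<inter> U' \<subseteq> insert q (F \<inter> U')" using miss by auto
    then have "card (F' \<inter> U') \<le> card (insert q (F \<inter> U'))"
      using fin by (intro card_mono) auto
    also have "\<dots> = card (F \<inter> U)" using fin FU False by simp
    finally show ?thesis using False True L' LU LV FV by (auto simp: potential_def)
  qed
next
  case False
  note LU = end_point[OF False]
  show ?thesis
  proof (cases "card L = k")
    case full: True
    from fullL[OF False full] obtain e where e: "e \<in> L" "e \<in> V" "L' = insert q (L - {e})" by auto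
    \<comment> \<open>The full LRU cache lies entirely behind \<open>p\<close>, so all
      \<open>k\<close> pages of \<open>L'\<close> lie in \<open>V'\<close>. FIFO holds at most
      \<open>k\<close> pages, hence the surplus behind is 0.\<close>
    have "L \<subseteq> V" using LU UV p by auto
    then have "L' \<inter> V' = L'" using e V' by auto
    moreover have "card L' = k"
      using e fin full False card_Suc_Diff1[of L e] by simp
    moreover have "card (F' \<inter> V') \<le> k"
      using card_mono[of F' "F' \<inter> V'"] fin cardF' by auto
    ultimately have B: "card (F' \<inter> V') - card (L' \<inter> V') = 0" by simp
    have "L' \<inter> U' = {q}" using e LU U' q p by auto
    then have A: "card (L' \<inter> U') = 1" by simp
    have FU: "card (F \<inter> U) = Suc (card (F \<inter> U'))"
    proof -
      have "F \<inter> U = insert p (F \<inter> U')" using p U' by auto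
      then show ?thesis using fin U' by simp
    qed
    have qU': "q \<in> U'" using q p U' by auto
    show ?thesis
    proof (cases "q \<in> F")
      case True
      \<comment> \<open>Only LRU faults here. As FIFO holds both \<open>p\<close> and
        \<open>q\<close> on the ray ahead, the surplus there was positive; it drops by one and pays
        for the fault.\<close>
      then have "card (F \<inter> U') > 0" using qU' fin by (auto simp: card_gt_0_iff)
      then show ?thesis using True False hit A B FU LU by (auto simp: potential_def)
    next
      case nF: False
      \<comment> \<open>Both fault. On the ray ahead \<open>q\<close> at most makes up for the loss
        of \<open>p\<close>, so the surplus does not grow.\<close>
      have "F' \<inter> U' \<subseteq> insert q (F \<inter> U')" using miss by auto
      then have "card (F' \<inter> U') \<le> card (insert q (F \<inter> U'))"
        using fin by (intro card_mono) auto
      also have "\<dots> = card (F \<inter> U)" using fin FU nF by simp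
      finally show ?thesis using False nF A B LU by (auto simp: potential_def)
    qed
  next
    case cold: False
    then show ?thesis using same False coldF coldL by (auto simp: potential_def)
  qed
qed

section \<open>The LRU cache on a path\<close>

lemma arg_min_on_eqI:
  assumes "finite S" "x \<in> S" "\<And>y. y \<in> S \<Longrightarrow> y \<noteq> x \<Longrightarrow> f x < (f y :: nat)"
  shows "arg_min_on f S = x"
  using arg_min_if_finite[of S f] assms by blast

text \<open>A walk on a path reaches \<open>p\<close> only through the pages in between, so last
  requests get older away from \<open>p\<close> on both sides. Stamps on opposite sides stay
  unordered: at a fault \<open>p\<close> is an end of the interval and only one side is
  left.\<close>

definition unimodal_cache :: "nat paging_state \<Rightarrow> nat \<Rightarrow> bool" where
  "unimodal_cache s p \<longleftrightarrow> (\<exists>l r. cache s = {l..r} \<and> l \<le> p \<and> p \<le> r \<and>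
     (\<forall>x y. l \<le> x \<longrightarrow> x < y \<longrightarrow> y \<le> p \<longrightarrow> stamp s x < stamp s y) \<and>
     (\<forall>x y. p \<le> y \<longrightarrow> y < x \<longrightarrow> x \<le> r \<longrightarrow> stamp s x < stamp s y))"

lemma unimodal_cache_mem: "unimodal_cache s p \<Longrightarrow> p \<in> cache s"
  by (auto simp: unimodal_cache_def)

lemma unimodal_cacheI:
  assumes "cache s = {l..r}" "l \<le> p" "p \<le> r"
    "\<And>x y. l \<le> x \<Longrightarrow> x < y \<Longrightarrow> y \<le> p \<Longrightarrow> stamp s x < stamp s y"
    "\<And>x y. p \<le> y \<Longrightarrow> y < x \<Longrightarrow> x \<le> r \<Longrightarrow> stamp s x < stamp s y"
  shows "unimodal_cache s p"
  using assms unfolding unimodal_cache_def by blast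

text \<open>The peak moves with the request: \<open>q\<close> gets the newest stamp, and adjacency
  leaves no page between the old peak and the new one.\<close>

lemma unimodal_cache_lru_hit:
  assumes u: "unimodal_cache s p" and v: "valid_state k s" and q: "q \<in> cache s"
    and adj: "q = p \<or> q = Suc p \<or> p = Suc q"
  shows "unimodal_cache (lru_step k s q) q"
proof -
  from u obtain l r where lr: "cache s = {l..r}" "l \<le> p" "p \<le> r"
    and inc: "\<And>x y. l \<le> x \<Longrightarrow> x < y \<Longrightarrow> y \<le> p \<Longrightarrow> stamp s x < stamp s y"
    and dec: "\<And>x y. p \<le> y \<Longrightarrow> y < x \<Longrightarrow> x \<le> r \<Longrightarrow> stamp s x < stamp s y"
    unfolding unimodal_cache_def by blast
  have clock: "stamp s x < clock s" if "l \<le> x" "x \<le> r" for x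
    using v lr that by (auto simp: valid_state_def)
  show ?thesis
    by (rule unimodal_cacheI[of _ l r])
      (use lr inc dec clock adj q in \<open>auto simp: lru_step_def\<close>)
qed

text \<open>An interval that contains \<open>p\<close> but not \<open>Suc p\<close> ends at
  \<open>p\<close>, so stamps increase along the whole cache and the left end is the page to
  evict.\<close>

lemma unimodal_cache_lru_fault_right:
  assumes u: "unimodal_cache s p" and v: "valid_state k s" and q: "Suc p \<notin> cache s"
  shows "unimodal_cache (lru_step k s (Suc p)) (Suc p)"
    and "cache s \<inter> {p..} = {p}"
    and "card (cache s) = k \<Longrightarrow>
      \<exists>e\<in>cache s \<inter> {..p}. cache (lru_step k s (Suc p)) = insert (Suc p) (cache s - {e})"
proof -
  from u obtain l r where lr: "cache s = {l..r}" "l \<le> p" "p \<le> r"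
    and inc: "\<And>x y. l \<le> x \<Longrightarrow> x < y \<Longrightarrow> y \<le> p \<Longrightarrow> stamp s x < stamp s y"
    unfolding unimodal_cache_def by blast
  have r: "r = p" using lr q by auto
  have clock: "stamp s x < clock s" if "l \<le> x" "x \<le> r" for x
    using v lr that by (auto simp: valid_state_def)
  have "arg_min_on (stamp s) (cache s) = l"
    by (rule arg_min_on_eqI) (use lr r inc in auto)
  then have evict: "make_room k s = (if card (cache s) = k then cache s - {l} else cache s)"
    by (simp add: make_room_def)
  \<comment> \<open>The left end moves only if the cache is full. For \<open>k = 1\<close> this
    gives \<open>l' = Suc p\<close>, a single page.\<close>
  define l' where "l' = (if card (cache s) = k then Suc l else l)"
  have c: "cache (lru_step k s (Suc p)) = {l'..Suc p}"
  proof -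
    have "insert (Suc p) ({l..r} - {l}) = {Suc l..Suc p}" "insert (Suc p) {l..r} = {l..Suc p}"
      using lr(2) r by auto
    then show ?thesis using q
      by (simp del: atLeastAtMost_iff add: lru_step_def evict l'_def lr(1))
  qed
  have l': "l \<le> l'" "l' \<le> Suc p" using lr r by (auto simp: l'_def)
  show "unimodal_cache (lru_step k s (Suc p)) (Suc p)"
    by (rule unimodal_cacheI[OF c]) (use l' r inc clock in \<open>auto simp: lru_step_def\<close>)
  show "cache s \<inter> {p..} = {p}" using lr r by auto
  show "\<exists>e\<in>cache s \<inter> {..p}. cache (lru_step k s (Suc p)) = insert (Suc p) (cache s - {e})"
    if "card (cache s) = k"
    using lr r q that by (intro bexI[of _ l]) (auto simp: lru_step_def evict)
qed

text \<open>Mirror image of the fault to the right. Writing the current page as \<open>Suc q\<close>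
  avoids truncated predecessors.\<close>

lemma unimodal_cache_lru_fault_left:
  assumes u: "unimodal_cache s (Suc q)" and v: "valid_state k s" and q: "q \<notin> cache s"
  shows "unimodal_cache (lru_step k s q) q"
    and "cache s \<inter> {..Suc q} = {Suc q}"
    and "card (cache s) = k \<Longrightarrow>
      \<exists>e\<in>cache s \<inter> {Suc q..}. cache (lru_step k s q) = insert q (cache s - {e})"
proof -
  from u obtain l r where lr: "cache s = {l..r}" "l \<le> Suc q" "Suc q \<le> r"
    and dec: "\<And>x y. Suc q \<le> y \<Longrightarrow> y < x \<Longrightarrow> x \<le> r \<Longrightarrow> stamp s x < stamp s y"
    unfolding unimodal_cache_def by blast
  have l: "l = Suc q" using lr q by auto
  have clock: "stamp s x < clock s" if "l \<le> x" "x \<le> r" for x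
    using v lr that by (auto simp: valid_state_def)
  have "arg_min_on (stamp s) (cache s) = r"
    by (rule arg_min_on_eqI) (use lr l dec in auto)
  then have evict: "make_room k s = (if card (cache s) = k then cache s - {r} else cache s)"
    by (simp add: make_room_def)
  \<comment> \<open>Since \<open>Suc q \<le> r\<close>, the difference \<open>r - 1\<close> is a
    true predecessor and is at least \<open>q\<close>.\<close>
  define r' where "r' = (if card (cache s) = k then r - 1 else r)"
  have c: "cache (lru_step k s q) = {q..r'}"
  proof -
    have "insert q ({l..r} - {r}) = {q..r - 1}" "insert q {l..r} = {q..r}"
      using lr(3) l by auto
    then show ?thesis using q
      by (simp del: atLeastAtMost_iff add: lru_step_def evict r'_def lr(1))
  qed
  have r': "r' \<le> r" "q \<le> r'" using lr l by (auto simp: r'_def)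
  show "unimodal_cache (lru_step k s q) q"
    by (rule unimodal_cacheI[OF c]) (use r' l dec clock in \<open>auto simp: lru_step_def\<close>)
  show "cache s \<inter> {..Suc q} = {Suc q}" using lr l by auto
  show "\<exists>e\<in>cache s \<inter> {Suc q..}. cache (lru_step k s q) = insert q (cache s - {e})"
    if "card (cache s) = k"
    using lr l q that by (intro bexI[of _ r]) (auto simp: lru_step_def evict)
qed

section \<open>Induction over the requests\<close>

text \<open>An amortised comparison: each step's LRU fault is paid by a FIFO fault or a drop in
  potential. The disjunction records that both caches coincide until LRU's is full.\<close>

lemma faults_lru_le_fifo:
  assumes k: "k \<ge> 1"
  shows "unimodal_cache s p \<Longrightarrow> valid_state k s \<Longrightarrow> valid_state k t \<Longrightarrow> p \<in> cache t \<Longrightarrow>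
    card (cache s) = k \<or> cache t = cache s \<Longrightarrow>
    successively (\<lambda>p q. q = p \<or> q = Suc p \<or> p = Suc q) (p # ps) \<Longrightarrow>
    faults (lru_step k) s ps
      \<le> faults (fifo_step k) t ps + potential {p..} {..p} (cache s) (cache t)"
proof (induction ps arbitrary: s t p)
  case Nil
  then show ?case by simp
next
  case (Cons q ps)
  note u = Cons.prems(1) and vs = Cons.prems(2) and vt = Cons.prems(3)
    and pt = Cons.prems(4) and same = Cons.prems(5)
  define s' where "s' = lru_step k s q"
  define t' where "t' = fifo_step k t q"
  have ps: "p \<in> cache s" using u by (rule unimodal_cache_mem)
  have adj: "q = p \<or> q = Suc p \<or> p = Suc q" using Cons.prems(6) by simp
  have vs': "valid_state k s'" and vt': "valid_state k t'"
    using valid_state_step k vs vt by (auto simp: s'_def t'_def)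
  have u': "unimodal_cache s' q"
    using adj unimodal_cache_lru_hit[OF u vs _ adj] unimodal_cache_lru_fault_right[OF u vs]
      unimodal_cache_lru_fault_left[OF _ vs] u ps
    unfolding s'_def by blast
  have qt': "q \<in> cache t'" by (auto simp: t'_def fifo_step_def)
  have hit_s: "cache s' = cache s" if "q \<in> cache s"
    using that by (simp add: s'_def lru_step_def)
  have hit_t: "cache t' = cache t" if "q \<in> cache t"
    using that by (simp add: t'_def fifo_step_def)
  have miss_t: "cache t' \<subseteq> insert q (cache t)"
    using make_room_valid(3)[OF k vt] by (auto simp: t'_def fifo_step_def)
  have cold_s: "cache s' = insert q (cache s)" if "card (cache s) \<noteq> k" "q \<notin> cache s"
    using that by (simp add: s'_def lru_step_def make_room_def)
  have cold_t: "cache t' = insert q (cache t)" if "card (cache t) \<noteq> k" "q \<notin> cache t"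
    using that by (simp add: t'_def fifo_step_def make_room_def)
  have fin: "finite (cache s)" "finite (cache t)" "finite (cache t')" and ct': "card (cache t') \<le> k"
    using vs vt vt' by (auto simp: valid_state_def)
  have full: "card (cache s') = k" if "card (cache s) = k"
  proof (cases "q \<in> cache s")
    case True
    then show ?thesis using that hit_s by simp
  next
    case False
    have "\<exists>e\<in>cache s. cache s' = insert q (cache s - {e})"
      using adj
    proof (elim disjE)
      assume "q = p"
      then show ?thesis using False ps by simp
    next
      assume "q = Suc p"
      then show ?thesis
        using unimodal_cache_lru_fault_right(3)[OF u vs] False that by (auto simp: s'_def)
    next
      assume "p = Suc q"
      then show ?thesis
        using unimodal_cache_lru_fault_left(3)[OF _ vs] u False that by (auto simp: s'_def)
    qed
    then obtain e where "e \<in> cache s" "cache s' = insert q (cache s - {e})"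
      by blast
    then show ?thesis using fin that False card_Suc_Diff1[of "cache s" e] by simp
  qed
  \<comment> \<open>A full LRU cache stays full. Before that the caches agree, so both hit or both
    add \<open>q\<close> without eviction.\<close>
  have same': "card (cache s') = k \<or> cache t' = cache s'"
    using same full hit_s hit_t cold_s cold_t by metis
  have step: "(if q \<in> cache s then 0 else 1) + potential {q..} {..q} (cache s') (cache t')
      \<le> (if q \<in> cache t then 0 else 1) + potential {p..} {..p} (cache s) (cache t)"
  proof -
    consider "q = p" | "q = Suc p" | "p = Suc q" using adj by blast
    then show ?thesis
    proof cases
      case 1
      then show ?thesis using ps pt hit_s hit_t by simp
    next
      case 2
      have end_point: "cache s \<inter> {p..} = {p}" if "q \<notin> cache s"
        using unimodal_cache_lru_fault_right(2)[OF u vs] that 2 by blast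
      have full: "\<exists>e\<in>cache s \<inter> {..p}. cache s' = insert q (cache s - {e})"
        if "q \<notin> cache s" "card (cache s) = k"
        using unimodal_cache_lru_fault_right(3)[OF u vs] that unfolding s'_def 2 by blast
      have rays: "p \<in> {p..}" "p \<in> {..p}" "q \<in> {p..}" "q \<notin> {..p}"
        "{q..} = {p..} - {p}" "{..q} = insert q {..p}" "{p..} \<inter> {..p} = {p}" "{p..} \<union> {..p} = UNIV"
        using 2 by auto
      show ?thesis
        by (rule potential_step)
          (fact fin ps pt rays same hit_t miss_t ct' cold_t hit_s end_point cold_s full)+
    next
      case 3
      have end_point: "cache s \<inter> {..p} = {p}" if "q \<notin> cache s"
        using unimodal_cache_lru_fault_left(2)[OF u[unfolded 3] vs] that 3 by blast
      have full: "\<exists>e\<in>cache s \<inter> {p..}. cache s' = insert q (cache s - {e})"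
        if "q \<notin> cache s" "card (cache s) = k"
        using unimodal_cache_lru_fault_left(3)[OF u[unfolded 3] vs] that unfolding s'_def 3 by blast
      have rays: "p \<in> {..p}" "p \<in> {p..}" "q \<in> {..p}" "q \<notin> {p..}"
        "{..q} = {..p} - {p}" "{q..} = insert q {p..}" "{..p} \<inter> {p..} = {p}" "{..p} \<union> {p..} = UNIV"
        using 3 by auto
      show ?thesis
        \<comment> \<open>For a move to the left, swapping the rays puts \<open>{..p}\<close> in the
          role of the ray ahead.\<close>
        unfolding potential_commute[of "{_..}"]
        by (rule potential_step)
          (fact fin ps pt rays same hit_t miss_t ct' cold_t hit_s end_point cold_s full)+
    qed
  qed
  have "faults (lru_step k) s' ps
      \<le> faults (fifo_step k) t' ps + potential {q..} {..q} (cache s') (cache t')"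
    using Cons.prems(6) by (intro Cons.IH u' vs' vt' qt' same') auto
  with step show ?case by (simp add: s'_def t'_def)
qed

text \<open>The first request is split off because the empty cache has no current page. Both
  algorithms fault on it and reach the same cache \<open>{p}\<close>, where the potential is
  0.\<close>

lemma LRU_le_FIFO_path:
  assumes k: "k \<ge> 1" and I: "respects_graph (path_graph N) I"
  shows "LRU k I \<le> FIFO k I"
proof (cases I)
  case Nil
  then show ?thesis by (simp add: LRU_def FIFO_def)
next
  case (Cons p ps)
  define s where "s = lru_step k initial p"
  define t where "t = fifo_step k initial p"
  have c: "cache s = {p}" "cache t = {p}"
    using k by (auto simp: s_def t_def lru_step_def fifo_step_def initial_def make_room_def)
  have v: "valid_state k s" "valid_state k t"
    using valid_state_step[OF k valid_state_initial] by (auto simp: s_def t_def)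
  have u: "unimodal_cache s p" by (rule unimodal_cacheI[of _ p p]) (use c in auto)
  have walk: "successively (\<lambda>p q. q = p \<or> q = Suc p \<or> p = Suc q) (p # ps)"
    using I unfolding Cons respects_graph_def path_graph_def
    by (auto elim!: successively_mono simp: doubleton_eq_iff)
  have "faults (lru_step k) s ps
      \<le> faults (fifo_step k) t ps + potential {p..} {..p} (cache s) (cache t)"
    by (rule faults_lru_le_fifo[OF k u v _ _ walk]) (use c in auto)
  also have "potential {p..} {..p} (cache s) (cache t) = 0"
    using c by (simp add: potential_def)
  finally show ?thesis
    by (simp add: Cons LRU_def FIFO_def s_def t_def initial_def)
qed

theorem theorem2:
  fixes k N :: nat and I :: "nat list"
  assumes "k \<ge> 1"
    and "respects_graph (path_graph N) I"
  shows "worst_order (LRU k) (path_graph N) I \<le> worst_order (FIFO k) (path_graph N) I"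
proof -
  let ?G = "path_graph N"
  let ?S = "\<lambda>A. {A (permute_list \<sigma> I) | \<sigma>.
      \<sigma> permutes {..<length I} \<and> respects_graph ?G (permute_list \<sigma> I)}"
  \<comment> \<open>Each reordering that LRU may use is compared with FIFO on the same
    reordering.\<close>
  have "x \<le> Max (?S (FIFO k))" if x: "x \<in> ?S (LRU k)" for x
  proof -
    from x obtain \<sigma> where \<sigma>: "x = LRU k (permute_list \<sigma> I)" "\<sigma> permutes {..<length I}"
      "respects_graph ?G (permute_list \<sigma> I)" by auto
    have "x \<le> FIFO k (permute_list \<sigma> I)" using LRU_le_FIFO_path assms \<sigma> by simp
    also have "\<dots> \<le> Max (?S (FIFO k))"
      using \<sigma> by (intro Max_ge worst_order_set) auto
    finally show ?thesis .
  qed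
  then show ?thesis
    unfolding worst_order_def
    \<comment> \<open>The set for LRU is nonempty because \<open>I\<close> itself respects the
      graph.\<close>
    using worst_order_set(1)[of "LRU k" I ?G] worst_order_set(2)[OF assms(2), of "LRU k"]
    by (subst Max_le_iff) auto
qed

end
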